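(* Let $n\ge k\ge 1$ be integers and let $\mathsf{U}_{k,n}$ be the uniform geometric lattice of rank $k$ on $n$ elements. Then every zero of the Chow polynomial $\underline{H}_{\mathsf{U}_{k,n}}(t)$ is real.
   Context: All posets are finite, bounded (least element $\widehat 0$, greatest element $\widehat 1$) and graded with rank function $\rho$, $\rho(\widehat 0)=0$; $\rho(P):=\rho(\widehat 1)$. The Boolean algebra $\mathsf{B}_n$ is the power set of $\{1,\dots,n\}$ ordered by inclusion. The truncation $\tau(P)$ of $P$ is the poset obtained from $P$ by removing all coatoms (elements of rank $\rho(P)-1$). The uniform geometric lattice is $\mathsf{U}_{k,n}:=\tau^{n-k}(\mathsf{B}_n)$ (truncate $n-k$ times). Chow polynomial: let $\mu$ be the Möbius function of $P$. For $x\le y$ put $\chi_{[x,y]}(t)=\sum_{x\le z\le y}\mu(x,z)t^{\rho(y)-\rho(z)}$, and define $\overline{\chi}_{[x,x]}(t)=-1$ and $\overline{\chi}_{[x,y]}(t)=\chi_{[x,y]}(t)/(t-1)$ for $x<y$ (this is a polynomial). Define $\underline{H}_{[x,x]}(t)=1$ and, for $x<y$, recursively $\underline{H}_{[x,y]}(t)=\sum_{x<z\le y}\overline{\chi}_{[x,z]}(t)\,\underline{H}_{[z,y]}(t)$ (equivalently $\underline{H}$ is the inverse of $-\overline\chi$ in the incidence algebra). The Chow polynomial of $P$ is $\underline{H}_P(t):=\underline{H}_{[\widehat0,\widehat1]}(t)$. *)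

theory Defs
  imports Complex_Main "HOL-Computational_Algebra.Polynomial"
begin

text \<open>
  A poset is a set \<open>P\<close> of elements of an ordered type, with the order restricted to \<open>P\<close>;
  its least and greatest elements are \<open>LEAST x. x \<in> P\<close> and \<open>GREATEST x. x \<in> P\<close>.
\<close>

definition covers_in :: "'a::order set \<Rightarrow> 'a \<Rightarrow> 'a \<Rightarrow> bool" where
  "covers_in P x y \<longleftrightarrow> x \<in> P \<and> y \<in> P \<and> x < y \<and> \<not> (\<exists>z\<in>P. x < z \<and> z < y)"

text \<open>The value \<open>0\<close> outside \<open>P\<close> is a convention that makes the rank function unique.\<close>

definition is_rank_function :: "'a::order set \<Rightarrow> ('a \<Rightarrow> nat) \<Rightarrow> bool" where
  "is_rank_function P r \<longleftrightarrow>
     r (LEAST x. x \<in> P) = 0 \<and>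
     (\<forall>x y. covers_in P x y \<longrightarrow> r y = r x + 1) \<and>
     (\<forall>x. x \<notin> P \<longrightarrow> r x = 0)"

definition bounded_graded_poset :: "'a::order set \<Rightarrow> bool" where
  "bounded_graded_poset P \<longleftrightarrow>
     finite P \<and> (\<exists>x\<in>P. \<forall>y\<in>P. x \<le> y) \<and> (\<exists>x\<in>P. \<forall>y\<in>P. y \<le> x) \<and>
     (\<exists>r. is_rank_function P r)"

definition rank_in :: "'a::order set \<Rightarrow> 'a \<Rightarrow> nat" where
  "rank_in P = (THE r. is_rank_function P r)"

definition poset_rank :: "'a::order set \<Rightarrow> nat" where
  "poset_rank P = rank_in P (GREATEST x. x \<in> P)"

text \<open>
  The recursions below are guarded by \<open>finite P\<close> and by membership in \<open>P\<close>, as needed for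
  termination.
\<close>

function moebius :: "'a::order set \<Rightarrow> 'a \<Rightarrow> 'a \<Rightarrow> int" where
  "moebius P x y =
     (if finite P \<and> x \<in> P \<and> y \<in> P \<and> x \<le> y
      then if x = y then 1 else - (\<Sum>z\<in>{z\<in>P. x \<le> z \<and> z < y}. moebius P x z)
      else 0)"
  by pat_completeness auto
termination
  by (relation "measure (\<lambda>(P, x, y). card {z\<in>P. z < y})")
     (auto intro!: psubset_card_mono)

declare moebius.simps [simp del]

definition char_poly_in :: "'a::order set \<Rightarrow> 'a \<Rightarrow> 'a \<Rightarrow> int poly" where
  "char_poly_in P x y =
     (\<Sum>z\<in>{z\<in>P. x \<le> z \<and> z \<le> y}. monom (moebius P x z) (rank_in P y - rank_in P z))"

text \<open>The division by \<open>t - 1\<close> is exact: see \<open>red_char_poly_in_mult\<close> below.\<close>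

definition red_char_poly_in :: "'a::order set \<Rightarrow> 'a \<Rightarrow> 'a \<Rightarrow> int poly" where
  "red_char_poly_in P x y = (if x = y then - 1 else char_poly_in P x y div [:- 1, 1:])"

function chow_poly_in :: "'a::order set \<Rightarrow> 'a \<Rightarrow> 'a \<Rightarrow> int poly" where
  "chow_poly_in P x y =
     (if finite P \<and> x \<in> P \<and> y \<in> P \<and> x \<le> y
      then if x = y then 1
           else (\<Sum>z\<in>{z\<in>P. x < z \<and> z \<le> y}. red_char_poly_in P x z * chow_poly_in P z y)
      else 0)"
  by pat_completeness auto
termination
  by (relation "measure (\<lambda>(P, x, y). card {z\<in>P. x < z})")
     (auto intro!: psubset_card_mono)

declare chow_poly_in.simps [simp del]

definition chow_poly :: "'a::order set \<Rightarrow> int poly" where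
  "chow_poly P = chow_poly_in P (LEAST x. x \<in> P) (GREATEST x. x \<in> P)"

text \<open>The coatoms are the elements of rank one less than the rank of the poset.\<close>

definition truncation :: "'a::order set \<Rightarrow> 'a set" where
  "truncation P = {x\<in>P. rank_in P x + 1 \<noteq> poset_rank P}"

definition boolean_algebra_poset :: "nat \<Rightarrow> nat set set" where
  "boolean_algebra_poset n = Pow {1..n}"

definition uniform_lattice :: "nat \<Rightarrow> nat \<Rightarrow> nat set set" where
  "uniform_lattice k n = (truncation ^^ (n - k)) (boolean_algebra_poset n)"


lemma Least_in_eqI:
  "x \<in> P \<Longrightarrow> (\<And>y. y \<in> P \<Longrightarrow> x \<le> y) \<Longrightarrow> (LEAST x. x \<in> P) = (x::'a::order)"
  by (rule Least_equality)

lemma Greatest_in_eqI: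
  "x \<in> P \<Longrightarrow> (\<And>y. y \<in> P \<Longrightarrow> y \<le> x) \<Longrightarrow> (GREATEST x. x \<in> P) = (x::'a::order)"
  by (rule Greatest_equality)

lemma rank_function_unique:
  fixes P :: "'a::order set"
  assumes fin: "finite P" and least: "b \<in> P" "\<And>y. y \<in> P \<Longrightarrow> b \<le> y"
    and r: "is_rank_function P r" and s: "is_rank_function P s"
  shows "r = s"
proof
  have b: "(LEAST x. x \<in> P) = b"
    using least by (rule Least_in_eqI)
  fix x show "r x = s x"
  proof (induction "card {z\<in>P. z < x}" arbitrary: x rule: less_induct)
    case less
    show ?case
    proof (cases "x \<in> P \<and> x \<noteq> b")
      case False
      then show ?thesis using r s b unfolding is_rank_function_def by metis
    next
      case True
      let ?A = "{z\<in>P. z < x}"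
      have "finite ?A" "b \<in> ?A"
        using fin least True by (auto simp: order.strict_iff_order)
      then obtain m where m: "m \<in> ?A" "\<And>z. z \<in> ?A \<Longrightarrow> m \<le> z \<Longrightarrow> m = z"
        using finite_has_maximal[of ?A] by blast
      have cov: "covers_in P m x"
        unfolding covers_in_def using m True by (auto dest: less_imp_le)
      have "{z\<in>P. z < m} \<subset> ?A" using m by auto
      then have "card {z\<in>P. z < m} < card ?A"
        using fin by (intro psubset_card_mono) auto
      then have "r m = s m" by (rule less)
      with cov r s show ?thesis unfolding is_rank_function_def by metis
    qed
  qed
qed

lemma rank_in_eqI:
  assumes "finite P" "b \<in> P" "\<And>y. y \<in> P \<Longrightarrow> b \<le> y" "is_rank_function P r"
  shows "rank_in P = r"
  unfolding rank_in_def using assms rank_function_unique[OF assms(1-3)] by (intro the_equality) auto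

lemma sum_moebius:
  assumes "finite P" "x \<in> P" "y \<in> P" "x < y"
  shows "(\<Sum>z\<in>{z\<in>P. x \<le> z \<and> z \<le> y}. moebius P x z) = 0"
proof -
  have "{z\<in>P. x \<le> z \<and> z \<le> y} = insert y {z\<in>P. x \<le> z \<and> z < y}"
    using assms by (auto simp: order.order_iff_strict)
  then show ?thesis
    using assms moebius.simps[of P x y] by auto
qed

lemma red_char_poly_in_mult:
  assumes "finite P" "x \<in> P" "y \<in> P" "x < y"
  shows "[:- 1, 1:] * red_char_poly_in P x y = char_poly_in P x y"
proof -
  have "poly (char_poly_in P x y) 1 = 0"
    using sum_moebius[OF assms] by (simp add: char_poly_in_def poly_sum poly_monom)
  then have "[:- 1, 1:] dvd char_poly_in P x y"
    by (simp add: poly_eq_0_iff_dvd)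
  then have "[:- 1, 1:] * (char_poly_in P x y div [:- 1, 1:]) = char_poly_in P x y"
    by (rule dvd_mult_div_cancel)
  then show ?thesis using assms unfolding red_char_poly_in_def by auto
qed

definition uniform_rank :: "nat \<Rightarrow> nat \<Rightarrow> nat set \<Rightarrow> nat" where
  "uniform_rank k n S = (if S = {1..n} then k else if S \<subseteq> {1..n} \<and> card S < k then card S else 0)"

lemma is_rank_function_uniform:
  assumes "1 \<le> k" "k \<le> n"
  shows "is_rank_function (insert {1..n} {S. S \<subseteq> {1..n} \<and> card S < k}) (uniform_rank k n)"
    (is "is_rank_function ?P _")
proof -
  have least: "(LEAST x. x \<in> ?P) = {}"
    using assms by (intro Least_in_eqI) auto
  have fin: "finite S" if "S \<in> ?P" for S
    using that finite_subset[of S "{1..n}"] by auto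
  have "uniform_rank k n T = uniform_rank k n S + 1" if cov: "covers_in ?P S T" for S T
  proof -
    have ST: "S \<in> ?P" "T \<in> ?P" "S \<subset> T"
      and no: "\<And>Z. Z \<in> ?P \<Longrightarrow> S \<subset> Z \<Longrightarrow> Z \<subset> T \<Longrightarrow> False"
      using cov unfolding covers_in_def by blast+
    have Tn: "T \<subseteq> {1..n}" using ST by auto
    have Sn: "S \<noteq> {1..n}" using ST Tn by auto
    have Sk: "S \<subseteq> {1..n}" "card S < k" using ST Sn by auto
    obtain a where a: "a \<in> T" "a \<notin> S" using ST by auto
    have ca: "card (insert a S) = card S + 1" using a fin ST by simp
    show ?thesis
    proof (cases "card S + 1 < k")
      case True
      then have "insert a S \<in> ?P" using Sk a Tn ca by auto
      then have T: "T = insert a S" using no[of "insert a S"] a ST by blast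
      then have "T \<noteq> {1..n}" using True ca assms by auto
      with T Sn Sk True ca Tn show ?thesis by (simp add: uniform_rank_def)
    next
      case False
      then have k: "k = card S + 1" using Sk by simp
      have "card S < card T" by (rule psubset_card_mono[OF fin[OF ST(2)] ST(3)])
      then have "T = {1..n}" using ST(2) k by simp
      with Sn Sk k show ?thesis by (simp add: uniform_rank_def)
    qed
  qed
  moreover have "uniform_rank k n {} = 0"
    using assms by (auto simp: uniform_rank_def)
  ultimately show ?thesis
    unfolding is_rank_function_def least by (auto simp: uniform_rank_def)
qed

lemma uniform_explicit:
  assumes "1 \<le> k" "k \<le> n"
  defines "P \<equiv> insert {1..n} {S. S \<subseteq> {1..n} \<and> card S < k}"
  shows "rank_in P = uniform_rank k n" "poset_rank P = k" "bounded_graded_poset P"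
proof -
  have fin: "finite P" unfolding P_def by (rule finite_subset[of _ "Pow {1..n}"]) auto
  have l: "{} \<in> P" using assms by (simp add: P_def)
  have rf: "is_rank_function P (uniform_rank k n)"
    unfolding P_def using assms by (intro is_rank_function_uniform)
  show 1: "rank_in P = uniform_rank k n"
    by (rule rank_in_eqI[OF fin l _ rf]) auto
  have "(GREATEST x. x \<in> P) = {1..n}"
    by (rule Greatest_in_eqI) (auto simp: P_def)
  then show "poset_rank P = k" by (simp add: poset_rank_def 1 uniform_rank_def)
  have "\<exists>x\<in>P. \<forall>y\<in>P. x \<le> y" using l by auto
  moreover have "\<exists>x\<in>P. \<forall>y\<in>P. y \<le> x" by (rule bexI[of _ "{1..n}"]) (auto simp: P_def)
  ultimately show "bounded_graded_poset P"
    unfolding bounded_graded_poset_def using fin rf by blast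
qed

lemma uniform_lattice_eq:
  assumes "1 \<le> k" "k \<le> n"
  shows "uniform_lattice k n = insert {1..n} {S. S \<subseteq> {1..n} \<and> card S < k}"
proof -
  have "uniform_lattice (n - j) n = insert {1..n} {S. S \<subseteq> {1..n} \<and> card S < n - j}"
    if "j < n" for j
    using that
  proof (induction j)
    case 0
    have "S = {1..n}" if "S \<subseteq> {1..n}" "\<not> card S < n" for S
      using that card_seteq[of "{1..n}" S] by auto
    then show ?case by (auto simp: uniform_lattice_def boolean_algebra_poset_def)
  next
    case (Suc j)
    define k where "k = n - Suc j"
    have k: "1 \<le> k" "Suc k \<le> n" "n - j = Suc k" "n - k = Suc j" "n - Suc k = j"
      using Suc.prems by (auto simp: k_def)
    let ?P = "insert {1..n} {S. S \<subseteq> {1..n} \<and> card S < Suc k}"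
    have IH: "uniform_lattice (Suc k) n = ?P" using Suc k by simp
    have "uniform_lattice k n = truncation (uniform_lattice (Suc k) n)"
      by (simp add: uniform_lattice_def k)
    also have "\<dots> = insert {1..n} {S. S \<subseteq> {1..n} \<and> card S < k}"
      unfolding IH truncation_def using uniform_explicit[of "Suc k" n] k
      by (auto simp: uniform_rank_def)
    finally show ?case by (simp add: k_def)
  qed
  from this[of "n - k"] assms show ?thesis by simp
qed

lemma bounded_graded_poset_uniform_lattice:
  assumes "1 \<le> k" "k \<le> n"
  shows "bounded_graded_poset (uniform_lattice k n)" "poset_rank (uniform_lattice k n) = k"
  using uniform_explicit[OF assms] uniform_lattice_eq[OF assms] by auto

end

theory Submission
  imports Defs "HOL-Library.Nonpos_Ints"
begin

text \<open>
  Write \<open>d\<^sub>m\<close> for the derangement polynomials and \<open>[q] = 1 + t + \<dots> + t\<^bsup>q-1\<^esup>\<close>. Umbrally (\<open>d\<^sup>m\<close>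
  standing for \<open>d\<^sub>m\<close>) one has \<open>t f(d + 1) - f(d + t) = (t - 1) f(0)\<close> for every polynomial \<open>f\<close>; for
  \<open>f(x) = (x - 1)\<^sup>p\<close> this is the recursion that identifies the Chow polynomial of the uniform lattice
  of rank \<open>k\<close> on \<open>n\<close> elements as \<open>\<Sum>m<k. (n choose m) d\<^sub>m [k - m]\<close>.

  Rewriting \<open>\<Sum>m<k. (n choose m) x\<^sup>m\<close> in the basis \<open>x\<^sup>j (1 + x)\<^bsup>k-1-j\<^esup>\<close> turns this sum into a
  nonnegative combination of polynomials that do not depend on \<open>n\<close> and satisfy a subtraction-free
  recursion in \<open>k\<close>. Up to a power of \<open>1 + t\<close> they are polynomials in \<open>s = t / (1 + t)\<^sup>2\<close>, and the
  recursion preserves interlacing in the following pointwise form: the quotient of a later value by an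
  earlier one lies in the convex cone spanned by \<open>1\<close> and \<open>s\<close>. Unless \<open>s\<close> is a nonpositive real,
  which forces \<open>t\<close> to be real, a combination with nonnegative weights, the first of them positive,
  therefore cannot vanish.
\<close>

section \<open>Binomial sums\<close>

lemma sum_choose_power_eq:
  fixes x :: "'a::comm_semiring_1"
  shows "(\<Sum>m\<le>N. of_nat (Suc (r + N) choose m) * x ^ m) =
    (\<Sum>j\<le>N. of_nat (r + j choose j) * (x ^ j * (1 + x) ^ (N - j)))"
proof (induction N)
  case (Suc N)
  have "(\<Sum>m\<le>Suc N. of_nat (Suc (r + Suc N) choose m) * x ^ m) =
      (\<Sum>m\<le>Suc N. of_nat (Suc (r + N) choose m) * x ^ m) +
      x * (\<Sum>m\<le>N. of_nat (Suc (r + N) choose m) * x ^ m)"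
    by (simp add: sum.atMost_Suc_shift sum_distrib_left algebra_simps
        del: sum.atMost_Suc flip: sum.distrib)
  also have "\<dots> = (1 + x) * (\<Sum>m\<le>N. of_nat (Suc (r + N) choose m) * x ^ m) +
      of_nat (r + Suc N choose Suc N) * x ^ Suc N"
    by (simp add: algebra_simps)
  also have "\<dots> = (\<Sum>j\<le>Suc N. of_nat (r + j choose j) * (x ^ j * (1 + x) ^ (Suc N - j)))"
    unfolding Suc.IH by (simp add: sum_distrib_left Suc_diff_le mult_ac)
  finally show ?case .
qed simp

lemma power_mult_power_telescope:
  fixes x :: "'a::comm_semiring_1"
  assumes "j \<le> Suc N"
  shows "x ^ j * (1 + x) ^ (Suc N - j) = x ^ Suc N + (\<Sum>i=j..<Suc N. x ^ i * (1 + x) ^ (N - i))"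
  using assms
proof (induction j rule: inc_induct)
  case (step j)
  then have "x ^ j * (1 + x) ^ (Suc N - j) =
      x ^ j * (1 + x) ^ (N - j) + x ^ Suc j * (1 + x) ^ (Suc N - Suc j)"
    by (simp add: Suc_diff_le algebra_simps)
  then show ?case
    using step by (simp add: sum.atLeast_Suc_lessThan add_ac del: sum.op_ivl_Suc)
qed simp

lemma choose_mult_choose:
  "(n choose m) * (n - m choose i) = (n choose (m + i)) * (m + i choose i)"
proof (cases "m + i \<le> n")
  case True
  then show ?thesis
    using choose_mult[of m "m + i" n] binomial_symmetric[of m "m + i"] by simp
qed (auto simp: binomial_eq_0)

lemma sum_subsets_by_card:
  fixes f :: "nat \<Rightarrow> 'b::comm_semiring_1"
  assumes "finite A"
  shows "(\<Sum>Y | Y \<subseteq> A \<and> card Y < k. f (card Y)) = (\<Sum>m<k. of_nat (card A choose m) * f m)"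
proof -
  let ?B = "{Y. Y \<subseteq> A \<and> card Y < k}"
  have "(\<Sum>Y\<in>?B. f (card Y)) = (\<Sum>m<k. \<Sum>Y | Y \<in> ?B \<and> card Y = m. f (card Y))"
    by (rule sum.group[symmetric]) (use assms in auto)
  also have "\<dots> = (\<Sum>m<k. of_nat (card A choose m) * f m)"
  proof (rule sum.cong)
    fix m assume "m \<in> {..<k}"
    then have "{Y \<in> ?B. card Y = m} = {Y. Y \<subseteq> A \<and> card Y = m}"
      by auto
    then show "(\<Sum>Y | Y \<in> ?B \<and> card Y = m. f (card Y)) = of_nat (card A choose m) * f m"
      using n_subsets[OF assms, of m] by simp
  qed simp
  finally show ?thesis .
qed

lemma sum_supersets_by_card:
  fixes f :: "nat \<Rightarrow> 'b::comm_semiring_1"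
  assumes "finite A" and "S \<subseteq> A"
  shows "(\<Sum>Z | S \<subseteq> Z \<and> Z \<subseteq> A \<and> card Z < k. f (card Z)) =
    (\<Sum>m<k - card S. of_nat (card A - card S choose m) * f (card S + m))"
proof -
  have finite_sub: "finite Z" if "Z \<subseteq> A" for Z
    using that assms(1) finite_subset by blast
  have card_Un: "card (S \<union> Y) = card S + card Y" if "Y \<subseteq> A - S" for Y
    using that finite_sub[of Y] finite_sub[OF assms(2)] by (intro card_Un_disjoint) auto
  have card_Diff: "card (Z - S) = card Z - card S" if "S \<subseteq> Z" for Z
    using that finite_sub[OF assms(2)] by (simp add: card_Diff_subset)
  have "(\<Sum>Z | S \<subseteq> Z \<and> Z \<subseteq> A \<and> card Z < k. f (card Z)) =
      (\<Sum>Y | Y \<subseteq> A - S \<and> card Y < k - card S. f (card S + card Y))"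
  proof (rule sum.reindex_bij_witness[of _ "\<lambda>Y. S \<union> Y" "\<lambda>Z. Z - S"])
    fix Z assume Z: "Z \<in> {Z. S \<subseteq> Z \<and> Z \<subseteq> A \<and> card Z < k}"
    then have "card S \<le> card Z" using finite_sub by (intro card_mono) auto
    with Z show "Z - S \<in> {Y. Y \<subseteq> A - S \<and> card Y < k - card S}"
      and "f (card S + card (Z - S)) = f (card Z)" by (auto simp: card_Diff)
  qed (use assms(2) in \<open>auto simp: card_Un\<close>)
  also have "\<dots> = (\<Sum>m<k - card S. of_nat (card (A - S) choose m) * f (card S + m))"
    by (rule sum_subsets_by_card) (use assms(1) in simp)
  finally show ?thesis using assms(2) by (simp add: card_Diff)
qed

lemma sum_proper_supersets_by_card:
  fixes f :: "nat \<Rightarrow> 'b::comm_ring_1"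
  assumes "finite A" and "S \<subseteq> A"
  shows "(\<Sum>Z | S \<subset> Z \<and> Z \<subseteq> A \<and> card Z < k. f (card Z)) =
    (\<Sum>m=1..<k - card S. of_nat (card A - card S choose m) * f (card S + m))"
proof (cases "card S < k")
  case True
  let ?I = "{Z. S \<subset> Z \<and> Z \<subseteq> A \<and> card Z < k}"
  have "finite ?I"
    by (rule finite_subset[of _ "Pow A"]) (use assms(1) in auto)
  have supersets: "{Z. S \<subseteq> Z \<and> Z \<subseteq> A \<and> card Z < k} = insert S ?I"
    using True assms(2) by auto
  have indices: "{..<k - card S} = insert 0 {1..<k - card S}"
    using True by auto
  show ?thesis
    using sum_supersets_by_card[OF assms, where k = k and f = f] \<open>finite ?I\<close>
    unfolding supersets indices by simp
next
  case False
  have "k \<le> card Z" if "S \<subset> Z" "Z \<subseteq> A" for Z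
    using False that card_mono[of Z S] finite_subset[OF that(2) assms(1)] by auto
  then have no_supersets: "{Z. S \<subset> Z \<and> Z \<subseteq> A \<and> card Z < k} = {}"
    unfolding Collect_empty_eq by (meson leD)
  show ?thesis unfolding no_supersets using False by simp
qed

section \<open>Umbral evaluation\<close>

definition umbral :: "(nat \<Rightarrow> 'a::comm_ring_1) \<Rightarrow> 'a poly \<Rightarrow> 'a" where
  "umbral a p = (\<Sum>i\<le>degree p. coeff p i * a i)"

lemma umbral_altdef:
  assumes "degree p \<le> n"
  shows "umbral a p = (\<Sum>i\<le>n. coeff p i * a i)"
  unfolding umbral_def
  by (rule sum.mono_neutral_left) (use assms in \<open>auto simp: coeff_eq_0\<close>)

lemma umbral_add: "umbral a (p + q) = umbral a p + umbral a q"
proof -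
  let ?n = "max (degree p) (degree q)"
  have "umbral a (p + q) = (\<Sum>i\<le>?n. coeff (p + q) i * a i)"
    by (rule umbral_altdef) (rule degree_add_le_max)
  also have "\<dots> = umbral a p + umbral a q"
    by (simp add: umbral_altdef[of _ ?n] distrib_right sum.distrib)
  finally show ?thesis .
qed

lemma umbral_smult: "umbral a (smult c p) = c * umbral a p"
  using umbral_altdef[OF degree_smult_le, of a c p]
  by (simp add: umbral_def sum_distrib_left mult.assoc)

lemma umbral_sum: "umbral a (\<Sum>i\<in>A. f i) = (\<Sum>i\<in>A. umbral a (f i))"
  by (induction A rule: infinite_finite_induct) (auto simp: umbral_add umbral_def[of a 0])

lemma umbral_monom: "umbral a (monom c n) = c * a n"
  using umbral_altdef[OF degree_monom_le, of a c n]
  by (simp add: if_distrib[of "\<lambda>x. x * _"] cong: if_cong)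

lemma umbral_power_X: "umbral a ([:0, 1:] ^ n) = a n"
  using umbral_monom[of a 1 n] by (simp add: monom_altdef)

lemma umbral_of_nat_mult: "umbral a (of_nat k * p) = of_nat k * umbral a p"
  by (simp add: of_nat_poly umbral_smult)

lemma umbral_linear_power:
  "umbral a ([:c, 1:] ^ n) = (\<Sum>i\<le>n. of_nat (n choose i) * c ^ (n - i) * a i)"
  by (simp add: umbral_def degree_linear_power coeff_linear_poly_power)

lemma umbral_cong:
  assumes "degree p \<le> n" and "\<And>i. i \<le> n \<Longrightarrow> a i = b i"
  shows "umbral a p = umbral b p"
  using assms by (simp add: umbral_def)

lemma umbral_add_scaled: "umbral (\<lambda>i. a i + c * b i) p = umbral a p + c * umbral b p"
  by (simp add: umbral_def algebra_simps sum.distrib sum_distrib_left)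

lemma one_plus_X: "1 + [:0, 1:] = ([:1, 1:] :: 'a::comm_semiring_1 poly)"
  by (simp add: one_pCons)

abbreviation (input) pascal_poly :: "nat \<Rightarrow> nat \<Rightarrow> 'a::comm_ring_1 poly" where
  "pascal_poly N j \<equiv> [:0, 1:] ^ j * [:1, 1:] ^ (N - j)"

lemma umbral_partial_binomial_sum:
  "(\<Sum>m\<le>N. of_nat (Suc (r + N) choose m) * a m) =
   (\<Sum>j\<le>N. of_nat (r + j choose j) * umbral a (pascal_poly N j))"
proof -
  have "(\<Sum>m\<le>N. of_nat (Suc (r + N) choose m) * a m) =
      umbral a (\<Sum>m\<le>N. of_nat (Suc (r + N) choose m) * [:0, 1:] ^ m)"
    by (simp only: umbral_sum umbral_of_nat_mult umbral_power_X)
  also have "\<dots> = (\<Sum>j\<le>N. of_nat (r + j choose j) * umbral a (pascal_poly N j))"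
    unfolding sum_choose_power_eq one_plus_X by (simp only: umbral_sum umbral_of_nat_mult)
  finally show ?thesis .
qed

lemma umbral_pascal_telescope:
  fixes a :: "nat \<Rightarrow> 'a::comm_ring_1"
  assumes "j \<le> Suc N"
  shows "umbral a (pascal_poly (Suc N) j) =
    a (Suc N) + (\<Sum>i=j..<Suc N. umbral a (pascal_poly N i))"
  using power_mult_power_telescope[OF assms, of "[:0, 1:] :: 'a poly"]
  by (simp only: one_plus_X umbral_add umbral_sum umbral_power_X)

section \<open>Derangement polynomials\<close>

definition q_int :: "'a::comm_semiring_1 \<Rightarrow> nat \<Rightarrow> 'a" where
  "q_int t n = (\<Sum>i<n. t ^ i)"

lemma q_int_0 [simp]: "q_int t 0 = 0"
  by (simp add: q_int_def)

lemma q_int_Suc: "q_int t (Suc n) = 1 + t * q_int t n"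
  by (simp add: q_int_def sum.lessThan_Suc_shift sum_distrib_left del: sum.lessThan_Suc)

lemma diff_one_mult_q_int: "(t - 1) * q_int t n = t ^ n - (1 :: 'a::comm_ring_1)"
  by (simp add: q_int_def power_diff_1_eq)

text \<open>\<open>\<Sum>\<sigma>. t\<^bsup>exc \<sigma>\<^esup>\<close> over the derangements \<open>\<sigma>\<close> of \<open>{1..n}\<close>, where \<open>exc\<close> counts excedances.\<close>

fun derangement_poly :: "'a::comm_semiring_1 \<Rightarrow> nat \<Rightarrow> 'a" where
  "derangement_poly t 0 = 1"
| "derangement_poly t (Suc n) =
    t * (\<Sum>m\<le>n. of_nat (Suc n choose m) * (derangement_poly t m * q_int t (n - m)))"

declare derangement_poly.simps(2) [simp del]

lemma umbral_derangement_shift: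
  fixes t :: "'a::comm_ring_1"
  shows "t * umbral (derangement_poly t) ([:1, 1:] ^ p) - umbral (derangement_poly t) ([:t, 1:] ^ p) =
   (if p = 0 then t - 1 else 0)"
proof (cases p)
  case 0
  then show ?thesis by (simp add: umbral_def)
next
  case (Suc n)
  have diff_power: "t - t ^ (Suc n - m) = - (t * (t - 1) * q_int t (n - m))" if "m \<le> n" for m
    using that by (simp only: mult.assoc diff_one_mult_q_int) (simp add: Suc_diff_le algebra_simps)
  have "t * umbral (derangement_poly t) ([:1, 1:] ^ p) - umbral (derangement_poly t) ([:t, 1:] ^ p) =
      (\<Sum>m\<le>Suc n. of_nat (Suc n choose m) * (t - t ^ (Suc n - m)) * derangement_poly t m)"
    unfolding umbral_linear_power Suc
    by (simp add: sum_distrib_left algebra_simps flip: sum_subtractf del: sum.atMost_Suc)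
  also have "\<dots> = (t - 1) * derangement_poly t (Suc n) +
      (\<Sum>m\<le>n. of_nat (Suc n choose m) * - (t * (t - 1) * q_int t (n - m)) * derangement_poly t m)"
    by (simp add: diff_power)
  also have "\<dots> = 0"
    by (simp add: derangement_poly.simps(2) sum_distrib_left sum_negf mult_ac)
  finally show ?thesis using Suc by simp
qed

lemma derangement_poly_binomial_sum:
  fixes t :: "'a::comm_ring_1"
  shows "t * derangement_poly t p =
   (\<Sum>i\<le>p. of_nat (p choose i) * (t - 1) ^ (p - i) * derangement_poly t i) + (t - 1) * (- 1) ^ p"
proof -
  let ?D = "umbral (derangement_poly t)" and ?c = "\<lambda>i. of_nat (p choose i) * (- 1) ^ (p - i)"
  have shift: "[:b - 1, 1:] ^ p = (\<Sum>i\<le>p. smult (?c i) ([:b, 1:] ^ i))" for b :: 'a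
  proof -
    have "[:b - 1, 1:] ^ p = ([:b, 1:] + [:- 1:]) ^ p"
      by simp
    also have "\<dots> = (\<Sum>i\<le>p. smult (?c i) ([:b, 1:] ^ i))"
      unfolding binomial_ring by (simp add: of_nat_poly poly_const_pow mult_ac)
    finally show ?thesis .
  qed
  have "t * derangement_poly t p - ?D ([:t - 1, 1:] ^ p) =
      t * ?D ([:1 - 1, 1:] ^ p) - ?D ([:t - 1, 1:] ^ p)"
    by (simp add: umbral_power_X)
  also have "\<dots> = (\<Sum>i\<le>p. ?c i * (t * ?D ([:1, 1:] ^ i) - ?D ([:t, 1:] ^ i)))"
    unfolding shift by (simp add: umbral_sum umbral_smult sum_distrib_left algebra_simps sum_subtractf)
  also have "\<dots> = (t - 1) * (- 1) ^ p"
    by (simp add: umbral_derangement_shift if_distrib[of "\<lambda>x. _ * x"] mult_ac cong: if_cong)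
  finally show ?thesis
    by (simp add: umbral_linear_power algebra_simps)
qed

lemma derangement_poly_recursion:
  fixes t :: "'a::idom"
  assumes "t \<noteq> 1"
  shows "derangement_poly t p =
    (- 1) ^ p + (\<Sum>i<p. of_nat (p choose i) * (t - 1) ^ (p - Suc i) * derangement_poly t i)"
proof -
  have "(t - 1) * derangement_poly t p =
      (t - 1) * (- 1) ^ p + (\<Sum>i<p. of_nat (p choose i) * (t - 1) ^ (p - i) * derangement_poly t i)"
    using derangement_poly_binomial_sum[of t p] by (simp add: algebra_simps flip: lessThan_Suc_atMost)
  also have "(\<Sum>i<p. of_nat (p choose i) * (t - 1) ^ (p - i) * derangement_poly t i) =
      (\<Sum>i<p. (t - 1) * (of_nat (p choose i) * (t - 1) ^ (p - Suc i) * derangement_poly t i))"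
  proof (rule sum.cong[OF refl])
    fix i assume "i \<in> {..<p}"
    then have "(t - 1) ^ (p - i) = (t - 1) * (t - 1) ^ (p - Suc i)"
      by (simp flip: power_Suc add: Suc_diff_Suc)
    then show "of_nat (p choose i) * (t - 1) ^ (p - i) * derangement_poly t i =
        (t - 1) * (of_nat (p choose i) * (t - 1) ^ (p - Suc i) * derangement_poly t i)"
      by (simp only: mult_ac)
  qed
  finally have "(t - 1) * derangement_poly t p = (t - 1) * ((- 1) ^ p +
      (\<Sum>i<p. of_nat (p choose i) * (t - 1) ^ (p - Suc i) * derangement_poly t i))"
    by (simp only: distrib_left sum_distrib_left)
  then show ?thesis using assms by simp
qed

definition uniform_chow :: "'a::comm_ring_1 \<Rightarrow> nat \<Rightarrow> nat \<Rightarrow> 'a" where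
  "uniform_chow t k n =
    (\<Sum>m<k. of_nat (n choose m) * (derangement_poly t m * q_int t (k - m)))"

lemma uniform_chow_recursion:
  fixes t :: "'a::idom"
  assumes "t \<noteq> 1"
  shows "uniform_chow t k n =
    (\<Sum>p<k. of_nat (n choose p) * ((- 1) ^ p * q_int t (k - p))) +
    (\<Sum>m=1..<k. of_nat (n choose m) * ((t - 1) ^ (m - 1) * uniform_chow t (k - m) (n - m)))"
proof -
  have choose_product: "of_nat (n choose m) * of_nat (n - m choose i) =
      (of_nat (n choose (m + i)) * of_nat (m + i choose i) :: 'a)" for m i
    by (simp only: choose_mult_choose flip: of_nat_mult)
  have recursion: "derangement_poly t p - (- 1) ^ p =
      (\<Sum>i<p. of_nat (p choose i) * (t - 1) ^ (p - Suc i) * derangement_poly t i)" for p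
    using derangement_poly_recursion[OF assms, of p] by simp
  have "(\<Sum>m=1..<k. of_nat (n choose m) * ((t - 1) ^ (m - 1) * uniform_chow t (k - m) (n - m))) =
      (\<Sum>m=1..<k. \<Sum>i<k - m. of_nat (n choose m) * of_nat (n - m choose i) *
        ((t - 1) ^ (m - 1) * derangement_poly t i * q_int t (k - m - i)))"
    unfolding uniform_chow_def sum_distrib_left by (simp only: mult_ac)
  also have "\<dots> = (\<Sum>p<k. \<Sum>i<p. of_nat (n choose p) * of_nat (p choose i) *
        ((t - 1) ^ (p - Suc i) * derangement_poly t i * q_int t (k - p)))"
    unfolding sum.Sigma[OF finite_lessThan ballI[OF finite_lessThan]]
      sum.Sigma[OF finite_atLeastLessThan ballI[OF finite_lessThan]]
    by (rule sum.reindex_bij_witness[of _ "\<lambda>(p, i). (p - i, i)" "\<lambda>(m, i). (m + i, i)"])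
      (auto simp: choose_product)
  also have "\<dots> = (\<Sum>p<k. of_nat (n choose p) * ((derangement_poly t p - (- 1) ^ p) * q_int t (k - p)))"
    by (simp only: recursion sum_distrib_left sum_distrib_right mult_ac)
  finally show ?thesis
    by (simp add: uniform_chow_def algebra_simps sum_subtractf)
qed

lemma alternating_sum_q_int:
  fixes t :: "'a::idom"
  assumes "t \<noteq> 1" and "0 < n"
  shows "(\<Sum>m<n. of_nat (n choose m) * ((- 1) ^ m * q_int t (n - m))) = (t - 1) ^ (n - 1)"
proof -
  have "(t - 1) * (\<Sum>m<n. of_nat (n choose m) * ((- 1) ^ m * q_int t (n - m))) =
      (\<Sum>m<n. of_nat (n choose m) * ((- 1) ^ m * ((t - 1) * q_int t (n - m))))"
    by (simp only: sum_distrib_left mult_ac)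
  also have "\<dots> = (\<Sum>m\<le>n. of_nat (n choose m) * ((- 1) ^ m * (t ^ (n - m) - 1)))"
    by (simp add: diff_one_mult_q_int flip: lessThan_Suc_atMost)
  also have "\<dots> = (- 1 + t) ^ n - (- 1 + 1) ^ n"
    unfolding binomial_ring by (simp add: algebra_simps sum_subtractf)
  also have "\<dots> = (t - 1) * (t - 1) ^ (n - 1)"
    using assms(2) by (simp flip: power_Suc add: zero_power)
  finally show ?thesis using assms(1) by simp
qed

section \<open>The Chow polynomial of the uniform lattice\<close>

lemma moebius_eq_neg_sum:
  assumes "finite P" "x \<in> P" "y \<in> P" "x < y"
  shows "moebius P x y = - (\<Sum>z | z \<in> P \<and> x \<le> z \<and> z < y. moebius P x z)"
  using assms by (subst moebius.simps) auto

lemma red_char_poly_in_eq_sum: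
  fixes P :: "'a::order set"
  assumes "finite P" "x \<in> P" "y \<in> P" "x < y"
  shows "red_char_poly_in P x y =
    (\<Sum>z | z \<in> P \<and> x \<le> z \<and> z < y. of_int (moebius P x z) * q_int [:0, 1:] (rank_in P y - rank_in P z))"
proof -
  let ?I = "{z\<in>P. x \<le> z \<and> z < y}" and ?X = "[:0, 1:] :: int poly"
  have X_minus_one: "?X - 1 = [:- 1, 1:]"
    by (simp add: one_pCons)
  have monom_eq: "monom c k = of_int c * ?X ^ k" for c k
    by (simp add: monom_altdef of_int_poly)
  have "{z\<in>P. x \<le> z \<and> z \<le> y} = insert y ?I"
    using assms by (auto simp: order.order_iff_strict)
  then have "char_poly_in P x y = of_int (moebius P x y) +
      (\<Sum>z\<in>?I. of_int (moebius P x z) * ?X ^ (rank_in P y - rank_in P z))"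
    using assms by (simp add: char_poly_in_def monom_eq)
  also have "\<dots> = (\<Sum>z\<in>?I. of_int (moebius P x z) * (?X ^ (rank_in P y - rank_in P z) - 1))"
    unfolding moebius_eq_neg_sum[OF assms]
    by (simp add: right_diff_distrib sum_subtractf)
  also have "\<dots> = (?X - 1) * (\<Sum>z\<in>?I. of_int (moebius P x z) * q_int ?X (rank_in P y - rank_in P z))"
    by (simp only: sum_distrib_left mult.left_commute[of "?X - 1"] diff_one_mult_q_int)
  finally have "[:- 1, 1:] * red_char_poly_in P x y =
      [:- 1, 1:] * (\<Sum>z\<in>?I. of_int (moebius P x z) * q_int ?X (rank_in P y - rank_in P z))"
    unfolding red_char_poly_in_mult[OF assms] X_minus_one .
  then show ?thesis by (simp del: mult_pCons_left)
qed

lemma moebius_boolean_interval: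
  assumes "finite P" "finite T" "\<And>Z. S \<subseteq> Z \<Longrightarrow> Z \<subseteq> T \<Longrightarrow> Z \<in> P" "S \<subseteq> T"
  shows "moebius P S T = (- 1) ^ (card T - card S)"
  using assms(2-)
proof (induction "card T" arbitrary: T rule: less_induct)
  case less
  show ?case
  proof (cases "S = T")
    case True
    then show ?thesis using less.prems assms(1) by (simp add: moebius.simps)
  next
    case False
    let ?n = "card T - card S" and ?I = "{Z\<in>P. S \<subseteq> Z \<and> Z \<subset> T}"
    have "card S < card T"
      using False less.prems by (intro psubset_card_mono) auto
    have interval: "?I = {Z. S \<subseteq> Z \<and> Z \<subseteq> T \<and> card Z < card T}"
      using less.prems psubset_card_mono[of T] by auto
    have "moebius P S T = - (\<Sum>Z\<in>?I. moebius P S Z)"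
      using False less.prems assms(1) by (intro moebius_eq_neg_sum) auto
    also have "(\<Sum>Z\<in>?I. moebius P S Z) = (\<Sum>Z\<in>?I. (- 1) ^ (card Z - card S))"
      using less.prems interval by (intro sum.cong refl less.hyps) (auto intro: finite_subset)
    also have "\<dots> = (\<Sum>m<?n. of_nat (?n choose m) * (- 1) ^ m)"
      unfolding interval using sum_supersets_by_card[OF less.prems(1,3), of "\<lambda>c. (- 1) ^ (c - card S)"]
      by simp
    also have "\<dots> = - ((- 1) ^ ?n)"
      using choose_alternating_sum[of ?n, where 'a = int] \<open>card S < card T\<close>
      by (simp add: mult.commute add_eq_0_iff2 flip: lessThan_Suc_atMost)
    finally show ?thesis by simp
  qed
qed

lemma red_char_poly_in_truncated_boolean_interval:
  assumes "finite P" "finite A" "S \<in> P" "A \<in> P" "S \<subset> A"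
    and interval: "{Z\<in>P. S \<subseteq> Z \<and> Z \<subset> A} = {Z. S \<subseteq> Z \<and> Z \<subseteq> A \<and> card Z < k}"
    and rank_top: "rank_in P A = k"
    and rank: "\<And>Z. S \<subseteq> Z \<Longrightarrow> Z \<subseteq> A \<Longrightarrow> card Z < k \<Longrightarrow> rank_in P Z = card Z"
  shows "red_char_poly_in P S A =
    (\<Sum>m<k - card S. of_nat (card A - card S choose m) *
      ((- 1) ^ m * q_int [:0, 1:] (k - card S - m)))"
proof -
  let ?X = "[:0, 1:] :: int poly" and ?I = "{Z. S \<subseteq> Z \<and> Z \<subseteq> A \<and> card Z < k}"
  have moebius_below: "moebius P S Z = (- 1) ^ (card Z - card S)" if Z: "Z \<in> ?I" for Z
  proof (rule moebius_boolean_interval[OF assms(1)])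
    show "finite Z" using Z assms(2) finite_subset by auto
    fix Y assume "S \<subseteq> Y" "Y \<subseteq> Z"
    moreover have "card Y \<le> card Z" using \<open>Y \<subseteq> Z\<close> \<open>finite Z\<close> by (rule card_mono[rotated])
    ultimately have "Y \<in> ?I" using Z by auto
    then show "Y \<in> P" using interval by blast
  qed (use Z in auto)
  have "red_char_poly_in P S A =
      (\<Sum>Z\<in>?I. of_int (moebius P S Z) * q_int ?X (rank_in P A - rank_in P Z))"
    unfolding interval[symmetric] using assms(1,3,4,5) by (rule red_char_poly_in_eq_sum)
  also have "\<dots> = (\<Sum>Z\<in>?I. (- 1) ^ (card Z - card S) * q_int ?X (k - card Z))"
    by (rule sum.cong[OF refl]) (simp add: moebius_below rank_top rank)
  also have "\<dots> = (\<Sum>m<k - card S. of_nat (card A - card S choose m) *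
      ((- 1) ^ m * q_int ?X (k - card S - m)))"
    using sum_supersets_by_card[OF assms(2),
        of S "\<lambda>c. (- 1) ^ (c - card S) * q_int ?X (k - c)" k] assms(5) by simp
  finally show ?thesis .
qed

context
  fixes k n :: nat
  assumes rank_bounds: "1 \<le> k" "k \<le> n"
begin

lemma uniform_lattice_iff:
  "S \<in> uniform_lattice k n \<longleftrightarrow> S = {1..n} \<or> S \<subseteq> {1..n} \<and> card S < k"
  by (simp add: uniform_lattice_eq[OF rank_bounds])

lemma finite_uniform_lattice: "finite (uniform_lattice k n)"
  using bounded_graded_poset_uniform_lattice(1)[OF rank_bounds] by (simp add: bounded_graded_poset_def)

lemma rank_in_uniform_lattice_top: "rank_in (uniform_lattice k n) {1..n} = k"
  using uniform_explicit(1)[OF rank_bounds]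
  by (simp add: uniform_lattice_eq[OF rank_bounds] uniform_rank_def)

lemma rank_in_uniform_lattice_below:
  assumes "S \<subseteq> {1..n}" "card S < k"
  shows "rank_in (uniform_lattice k n) S = card S"
  using uniform_explicit(1)[OF rank_bounds] assms rank_bounds
  by (auto simp: uniform_lattice_eq[OF rank_bounds] uniform_rank_def)

lemma red_char_poly_in_uniform_lattice_top:
  assumes "S \<subseteq> {1..n}" "card S < k"
  shows "red_char_poly_in (uniform_lattice k n) S {1..n} =
    (\<Sum>m<k - card S. of_nat (n - card S choose m) * ((- 1) ^ m * q_int [:0, 1:] (k - card S - m)))"
proof -
  have "{Z \<in> uniform_lattice k n. S \<subseteq> Z \<and> Z \<subset> {1..n}} = {Z. S \<subseteq> Z \<and> Z \<subseteq> {1..n} \<and> card Z < k}"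
    using rank_bounds by (auto simp: uniform_lattice_iff)
  moreover have "S \<subset> {1..n}" using assms rank_bounds by auto
  ultimately show ?thesis
    using assms red_char_poly_in_truncated_boolean_interval[OF finite_uniform_lattice, of "{1..n}" S k]
      rank_in_uniform_lattice_top
    by (simp add: uniform_lattice_iff rank_in_uniform_lattice_below)
qed

lemma red_char_poly_in_uniform_lattice_below:
  assumes "S \<subset> T" "T \<subseteq> {1..n}" "card T < k"
  shows "red_char_poly_in (uniform_lattice k n) S T = ([:0, 1:] - 1) ^ (card T - card S - 1)"
proof -
  let ?U = "uniform_lattice k n" and ?n = "card T - card S"
  have "finite T" using assms(2) by (rule finite_subset) simp
  have below: "card Z \<le> card T" "Z \<in> ?U" if "Z \<subseteq> T" for Z
    using card_mono[OF \<open>finite T\<close> that] that assms(2,3) by (auto simp: uniform_lattice_iff)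
  have "{Z \<in> ?U. S \<subseteq> Z \<and> Z \<subset> T} = {Z. S \<subseteq> Z \<and> Z \<subseteq> T \<and> card Z < card T}"
    using below(2) psubset_card_mono[OF \<open>finite T\<close>] by auto
  then have "red_char_poly_in ?U S T =
      (\<Sum>m<?n. of_nat (?n choose m) * ((- 1) ^ m * q_int [:0, 1:] (?n - m)))"
    using assms below \<open>finite T\<close> finite_uniform_lattice
    by (intro red_char_poly_in_truncated_boolean_interval rank_in_uniform_lattice_below) auto
  also have "\<dots> = ([:0, 1:] - 1) ^ (?n - 1)"
    using psubset_card_mono[OF \<open>finite T\<close> assms(1)]
    by (intro alternating_sum_q_int) (simp_all add: one_pCons)
  finally show ?thesis .
qed

lemma chow_poly_in_uniform_lattice_recursion:
  assumes "S \<subseteq> {1..n}" "card S < k"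
  shows "chow_poly_in (uniform_lattice k n) S {1..n} =
    red_char_poly_in (uniform_lattice k n) S {1..n} +
    (\<Sum>Z | S \<subset> Z \<and> Z \<subseteq> {1..n} \<and> card Z < k.
       ([:0, 1:] - 1) ^ (card Z - card S - 1) * chow_poly_in (uniform_lattice k n) Z {1..n})"
proof -
  let ?U = "uniform_lattice k n" and ?I = "{Z. S \<subset> Z \<and> Z \<subseteq> {1..n} \<and> card Z < k}"
  have "finite ?I" "{1..n} \<notin> ?I" "S \<noteq> {1..n}" "{Z\<in>?U. S \<subset> Z \<and> Z \<subseteq> {1..n}} = insert {1..n} ?I"
    using assms rank_bounds by (auto simp: uniform_lattice_iff intro: finite_subset[of _ "Pow {1..n}"])
  moreover have "chow_poly_in ?U {1..n} {1..n} = 1"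
    by (simp add: chow_poly_in.simps finite_uniform_lattice uniform_lattice_iff)
  ultimately have "chow_poly_in ?U S {1..n} = red_char_poly_in ?U S {1..n} +
      (\<Sum>Z\<in>?I. red_char_poly_in ?U S Z * chow_poly_in ?U Z {1..n})"
    using assms by (subst chow_poly_in.simps) (simp add: finite_uniform_lattice uniform_lattice_iff)
  then show ?thesis
    by (simp add: red_char_poly_in_uniform_lattice_below)
qed

lemma chow_poly_in_uniform_lattice:
  assumes "S \<subseteq> {1..n}" "card S < k"
  shows "chow_poly_in (uniform_lattice k n) S {1..n} = uniform_chow [:0, 1:] (k - card S) (n - card S)"
  using assms
proof (induction "k - card S" arbitrary: S rule: less_induct)
  case less
  let ?X = "[:0, 1:] :: int poly" and ?I = "{Z. S \<subset> Z \<and> Z \<subseteq> {1..n} \<and> card Z < k}"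
  let ?H = "\<lambda>c. uniform_chow ?X (k - c) (n - c)"
  have "chow_poly_in (uniform_lattice k n) Z {1..n} = ?H (card Z)" if "Z \<in> ?I" for Z
  proof (rule less.hyps)
    have "card S < card Z"
      using that by (intro psubset_card_mono) (auto intro: finite_subset)
    then show "k - card Z < k - card S" using that by auto
  qed (use that in auto)
  then have "(\<Sum>Z\<in>?I. (?X - 1) ^ (card Z - card S - 1) * chow_poly_in (uniform_lattice k n) Z {1..n}) =
      (\<Sum>Z\<in>?I. (?X - 1) ^ (card Z - card S - 1) * ?H (card Z))"
    by simp
  also have "\<dots> = (\<Sum>m=1..<k - card S. of_nat (n - card S choose m) *
      ((?X - 1) ^ (m - 1) * uniform_chow ?X (k - card S - m) (n - card S - m)))"
    using sum_proper_supersets_by_card[of "{1..n}" S "\<lambda>c. (?X - 1) ^ (c - card S - 1) * ?H c" k]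
      less.prems(1) by simp
  finally show ?case
    unfolding chow_poly_in_uniform_lattice_recursion[OF less.prems]
      red_char_poly_in_uniform_lattice_top[OF less.prems]
    by (simp add: uniform_chow_recursion[of ?X "k - card S"] one_pCons)
qed

lemma chow_poly_uniform_lattice:
  "chow_poly (uniform_lattice k n) = uniform_chow [:0, 1:] k n"
proof -
  have "(LEAST S. S \<in> uniform_lattice k n) = {}"
    by (rule Least_in_eqI) (use rank_bounds in \<open>auto simp: uniform_lattice_iff\<close>)
  moreover have "(GREATEST S. S \<in> uniform_lattice k n) = {1..n}"
    by (rule Greatest_in_eqI) (auto simp: uniform_lattice_iff)
  ultimately show ?thesis
    using chow_poly_in_uniform_lattice[of "{}"] rank_bounds by (simp add: chow_poly_def)
qed

end

section \<open>The gamma expansion\<close>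

text \<open>The case \<open>k = N + 1\<close> supplies the terms of the Chow polynomial; the case \<open>k = N\<close> closes their
  recursion.\<close>

definition neville_part :: "'a::comm_ring_1 \<Rightarrow> nat \<Rightarrow> nat \<Rightarrow> nat \<Rightarrow> 'a" where
  "neville_part t k N j = umbral (\<lambda>m. derangement_poly t m * q_int t (k - m)) (pascal_poly N j)"

lemma uniform_chow_eq_sum_neville_part:
  assumes "Suc K \<le> n"
  shows "uniform_chow t (Suc K) n =
    (\<Sum>j\<le>K. of_nat (n - Suc K + j choose j) * neville_part t (Suc K) K j)"
  using assms umbral_partial_binomial_sum[where N = K and r = "n - Suc K"
      and a = "\<lambda>m. derangement_poly t m * q_int t (Suc K - m)"]
  by (simp add: uniform_chow_def neville_part_def lessThan_Suc_atMost)

lemma neville_part_telescope: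
  assumes "j \<le> Suc K"
  shows "neville_part t (Suc K) (Suc K) j = (\<Sum>i=j..<Suc K. neville_part t (Suc K) K i)"
  unfolding neville_part_def umbral_pascal_telescope[OF assms] by simp

lemma neville_part_Suc_rank:
  assumes "j \<le> N" "N \<le> k"
  shows "neville_part t (Suc k) N j =
    umbral (derangement_poly t) (pascal_poly N j) + t * neville_part t k N j"
proof -
  have "degree (pascal_poly N j :: 'a poly) \<le> N"
    using degree_mult_le[of "[:0, 1:] ^ j :: 'a poly" "[:1, 1:] ^ (N - j)"] assms(1)
    by (simp add: degree_linear_power)
  then have "neville_part t (Suc k) N j =
      umbral (\<lambda>m. derangement_poly t m + t * (derangement_poly t m * q_int t (k - m))) (pascal_poly N j)"
    unfolding neville_part_def
    by (rule umbral_cong) (use assms(2) in \<open>simp add: Suc_diff_le q_int_Suc algebra_simps\<close>)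
  then show ?thesis
    by (simp only: umbral_add_scaled neville_part_def)
qed

lemma derangement_poly_Suc_eq_sum_neville_part:
  "derangement_poly t (Suc K) = t * (\<Sum>i\<le>K. neville_part t K K i)"
  using umbral_partial_binomial_sum[where N = K and r = 0
      and a = "\<lambda>m. derangement_poly t m * q_int t (K - m)"]
  by (simp add: derangement_poly.simps(2) neville_part_def)

lemma neville_part_recursion:
  assumes "j \<le> Suc K"
  shows "neville_part t (Suc (Suc K)) (Suc K) j =
    (1 + t) * (\<Sum>i=j..<Suc K. neville_part t (Suc K) K i) + t * (\<Sum>i=0..<j. neville_part t K K i)"
proof -
  let ?D = "\<lambda>N j. umbral (derangement_poly t) (pascal_poly N j)"
  have "(\<Sum>i\<le>K. neville_part t K K i) =
      (\<Sum>i=0..<j. neville_part t K K i) + (\<Sum>i=j..<Suc K. neville_part t K K i)"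
    using assms sum.atLeastLessThan_concat[of 0 j "Suc K" "neville_part t K K"]
    by (simp add: atLeast0LessThan lessThan_Suc_atMost del: sum.op_ivl_Suc)
  then have "?D (Suc K) j = t * (\<Sum>i=0..<j. neville_part t K K i) +
      (\<Sum>i=j..<Suc K. t * neville_part t K K i + ?D K i)"
    unfolding umbral_pascal_telescope[OF assms] derangement_poly_Suc_eq_sum_neville_part
    by (simp only: sum.distrib sum_distrib_left distrib_left add.assoc)
  also have "(\<Sum>i=j..<Suc K. t * neville_part t K K i + ?D K i) =
      (\<Sum>i=j..<Suc K. neville_part t (Suc K) K i)"
    by (intro sum.cong) (auto simp: neville_part_Suc_rank)
  finally show ?thesis
    unfolding neville_part_Suc_rank[OF assms order_refl] neville_part_telescope[OF assms]
    by (simp only: distrib_right mult_1_left ac_simps)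
qed

fun chow_gamma :: "'a::comm_semiring_1 \<Rightarrow> nat \<Rightarrow> nat \<Rightarrow> 'a"
  and chow_gamma_tail :: "'a \<Rightarrow> nat \<Rightarrow> nat \<Rightarrow> 'a" where
  "chow_gamma s 0 j = 1"
| "chow_gamma s (Suc K) j =
    (\<Sum>i=j..<Suc K. chow_gamma s K i) + s * (\<Sum>i=0..<j. chow_gamma_tail s K i)"
| "chow_gamma_tail s 0 j = 0"
| "chow_gamma_tail s (Suc K) j = (\<Sum>i=j..<Suc K. chow_gamma s K i)"

lemma neville_part_eq_chow_gamma:
  fixes t :: "'a::field"
  assumes "1 + t \<noteq> 0"
  shows "j \<le> K \<Longrightarrow> neville_part t (Suc K) K j = (1 + t) ^ K * chow_gamma (t / (1 + t)\<^sup>2) K j"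
    and "j \<le> K \<Longrightarrow> (1 + t) * neville_part t K K j = (1 + t) ^ K * chow_gamma_tail (t / (1 + t)\<^sup>2) K j"
proof (induction K arbitrary: j)
  case 0
  case 1
  then show ?case by (simp add: neville_part_def umbral_def q_int_Suc)
next
  case 0
  case 2
  then show ?case by (simp add: neville_part_def umbral_def)
next
  case (Suc K)
  let ?s = "t / (1 + t)\<^sup>2"
  have sum_parts: "(\<Sum>i=j..<Suc K. neville_part t (Suc K) K i) =
      (1 + t) ^ K * (\<Sum>i=j..<Suc K. chow_gamma ?s K i)" for j
    unfolding sum_distrib_left by (intro sum.cong Suc.IH(1)) auto
  { case 1
    have sum_tail_parts: "(1 + t) * (\<Sum>i=0..<j. neville_part t K K i) =
        (1 + t) ^ K * (\<Sum>i=0..<j. chow_gamma_tail ?s K i)"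
      unfolding sum_distrib_left using 1 by (intro sum.cong Suc.IH(2)) auto
    have "t * (\<Sum>i=0..<j. neville_part t K K i) =
        t / (1 + t) * ((1 + t) * (\<Sum>i=0..<j. neville_part t K K i))"
      using assms by simp
    also have "\<dots> = (1 + t) ^ Suc K * (?s * (\<Sum>i=0..<j. chow_gamma_tail ?s K i))"
      unfolding sum_tail_parts using assms by (simp add: power2_eq_square)
    finally show ?case
      unfolding neville_part_recursion[OF 1] sum_parts chow_gamma.simps
      by (simp only: distrib_left power_Suc mult.assoc) }
  { case 2
    show ?case
      unfolding neville_part_telescope[OF 2] sum_parts chow_gamma_tail.simps
      by (simp only: power_Suc mult.assoc) }
qed

lemma uniform_chow_eq_sum_chow_gamma:
  fixes t :: "'a::field"
  assumes "1 + t \<noteq> 0" "Suc K \<le> n"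
  shows "uniform_chow t (Suc K) n = (1 + t) ^ K *
    (\<Sum>j\<le>K. of_nat (n - Suc K + j choose j) * chow_gamma (t / (1 + t)\<^sup>2) K j)"
  unfolding uniform_chow_eq_sum_neville_part[OF assms(2)] sum_distrib_left
  by (intro sum.cong) (auto simp: neville_part_eq_chow_gamma(1)[OF assms(1)])

section \<open>Interlacing\<close>

definition cone_one :: "complex \<Rightarrow> complex set" where
  "cone_one s = {of_real a + of_real b * s |a b. 0 \<le> a \<and> 0 \<le> b}"

lemma cone_oneI: "0 \<le> a \<Longrightarrow> 0 \<le> b \<Longrightarrow> of_real a + of_real b * s \<in> cone_one s"
  by (auto simp: cone_one_def)

lemma zero_in_cone_one [simp]: "0 \<in> cone_one s"
  using cone_oneI[of 0 0 s] by simp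

lemma cone_one_add:
  assumes "x \<in> cone_one s" "y \<in> cone_one s"
  shows "x + y \<in> cone_one s"
proof -
  obtain a b c d where "x = of_real a + of_real b * s" "y = of_real c + of_real d * s"
    and "0 \<le> a" "0 \<le> b" "0 \<le> c" "0 \<le> d"
    using assms by (auto simp: cone_one_def)
  then show ?thesis using cone_oneI[of "a + c" "b + d" s] by (simp add: algebra_simps)
qed

lemma cone_one_scale:
  assumes "0 \<le> r" "x \<in> cone_one s"
  shows "of_real r * x \<in> cone_one s"
proof -
  obtain a b where "x = of_real a + of_real b * s" "0 \<le> a" "0 \<le> b"
    using assms by (auto simp: cone_one_def)
  then show ?thesis using cone_oneI[of "r * a" "r * b" s] assms(1) by (simp add: algebra_simps)
qed

lemma mult_cnj_in_cone_one:
  assumes "x \<in> cone_one s"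
  shows "s * cnj x \<in> cone_one s"
proof -
  obtain a b where "x = of_real a + of_real b * s" "0 \<le> a" "0 \<le> b"
    using assms by (auto simp: cone_one_def)
  then show ?thesis
    using cone_oneI[of "b * (norm s)\<^sup>2" a s]
    by (simp add: complex_norm_square algebra_simps del: of_real_power)
qed

lemma of_real_add_cone_one_nonzero:
  assumes "0 < r" "x \<in> cone_one s" "s \<notin> \<real>\<^sub>\<le>\<^sub>0"
  shows "of_real r + x \<noteq> 0"
proof
  obtain a b where x_eq: "x = of_real a + of_real b * s" and "0 \<le> a" "0 \<le> b"
    using assms by (auto simp: cone_one_def)
  assume "of_real r + x = 0"
  then have b_mult_s: "of_real b * s = of_real (- (r + a))"
    by (simp add: x_eq algebra_simps eq_neg_iff_add_eq_0)
  then have "b \<noteq> 0" using assms(1) \<open>0 \<le> a\<close> by (auto simp del: of_real_minus of_real_add)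
  then have "s = of_real (- (r + a) / b)"
    using b_mult_s by (simp add: field_simps)
  moreover have "- (r + a) / b \<le> 0"
    using assms(1) \<open>0 \<le> a\<close> \<open>0 \<le> b\<close> by (intro divide_nonpos_nonneg) auto
  ultimately have "s \<in> \<real>\<^sub>\<le>\<^sub>0" by (simp only: nonpos_Reals_of_real_iff)
  then show False using assms(3) by contradiction
qed

text \<open>For \<open>u \<noteq> 0\<close> this says that \<open>v / u\<close> lies in the cone. The relation is not transitive.\<close>

definition interlaces :: "complex \<Rightarrow> complex \<Rightarrow> complex \<Rightarrow> bool" where
  "interlaces s u v \<longleftrightarrow> v * cnj u \<in> cone_one s"

lemma interlaces_zero [simp]: "interlaces s 0 v" "interlaces s u 0"
  by (simp_all add: interlaces_def)

lemma interlaces_refl: "interlaces s u u"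
  using cone_oneI[of "(norm u)\<^sup>2" 0 s]
  by (simp add: interlaces_def complex_norm_square del: of_real_power)

lemma interlaces_add_left: "interlaces s u w \<Longrightarrow> interlaces s v w \<Longrightarrow> interlaces s (u + v) w"
  by (simp add: interlaces_def distrib_left cone_one_add)

lemma interlaces_add_right: "interlaces s u v \<Longrightarrow> interlaces s u w \<Longrightarrow> interlaces s u (v + w)"
  by (simp add: interlaces_def distrib_right cone_one_add)

lemma interlaces_sum_left:
  "(\<And>i. i \<in> A \<Longrightarrow> interlaces s (f i) w) \<Longrightarrow> interlaces s (\<Sum>i\<in>A. f i) w"
  by (induction A rule: infinite_finite_induct) (auto intro: interlaces_add_left)

lemma interlaces_sum_right:
  "(\<And>i. i \<in> A \<Longrightarrow> interlaces s u (f i)) \<Longrightarrow> interlaces s u (\<Sum>i\<in>A. f i)"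
  by (induction A rule: infinite_finite_induct) (auto intro: interlaces_add_right)

lemma interlaces_scale_right: "0 \<le> r \<Longrightarrow> interlaces s u v \<Longrightarrow> interlaces s u (of_real r * v)"
  by (simp add: interlaces_def mult.assoc cone_one_scale)

lemma interlaces_mult:
  assumes "interlaces s u v"
  shows "interlaces s (c * u) (c * v)"
proof -
  have "c * v * cnj (c * u) = of_real ((norm c)\<^sup>2) * (v * cnj u)"
    unfolding complex_norm_square by (simp add: mult_ac)
  with assms show ?thesis by (simp only: interlaces_def cone_one_scale zero_le_power2)
qed

lemma interlaces_rotate:
  assumes "interlaces s u v"
  shows "interlaces s v (s * u)"
  using mult_cnj_in_cone_one[of "v * cnj u" s] assms by (simp add: interlaces_def mult_ac)

lemma weighted_sum_nonzero_if_interlaces: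
  fixes w :: "nat \<Rightarrow> real"
  assumes "s \<notin> \<real>\<^sub>\<le>\<^sub>0" and "g 0 \<noteq> 0" and "\<And>j. j \<le> K \<Longrightarrow> interlaces s (g 0) (g j)"
    and "0 < w 0" and "\<And>j. 0 \<le> w j"
  shows "(\<Sum>j\<le>K. of_real (w j) * g j) \<noteq> 0"
proof
  define r where "r = (\<Sum>j\<in>{..K} - {0}. of_real (w j) * g j)"
  have "interlaces s (g 0) r"
    unfolding r_def using assms by (intro interlaces_sum_right interlaces_scale_right) auto
  then have "r * cnj (g 0) \<in> cone_one s" by (simp only: interlaces_def)
  then have "of_real (w 0 * (norm (g 0))\<^sup>2) + r * cnj (g 0) \<noteq> 0"
    using assms by (intro of_real_add_cone_one_nonzero) auto
  moreover assume "(\<Sum>j\<le>K. of_real (w j) * g j) = 0"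
  then have "of_real (w 0) * g 0 + r = 0"
    by (simp add: r_def sum.remove[of "{..K}" 0])
  then have "(of_real (w 0) * g 0 + r) * cnj (g 0) = 0" by simp
  ultimately show False
    by (simp add: complex_norm_square algebra_simps del: of_real_power)
qed

text \<open>Comparing sums over intervals, rather than single entries, makes up for the missing transitivity.\<close>

definition interval_interlacing :: "complex \<Rightarrow> nat \<Rightarrow> (nat \<Rightarrow> complex) \<Rightarrow> (nat \<Rightarrow> complex) \<Rightarrow> bool" where
  "interval_interlacing s N f g \<longleftrightarrow>
    (\<forall>a b c d. a \<le> c \<longrightarrow> b \<le> d \<longrightarrow> d \<le> N \<longrightarrow> interlaces s (\<Sum>i=a..<b. f i) (\<Sum>i=c..<d. g i))"

lemma interval_interlacingD:
  "interval_interlacing s N f g \<Longrightarrow> a \<le> c \<Longrightarrow> b \<le> d \<Longrightarrow> d \<le> N \<Longrightarrow>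
    interlaces s (\<Sum>i=a..<b. f i) (\<Sum>i=c..<d. g i)"
  by (simp add: interval_interlacing_def)

lemma interval_interlacing_imp_interlaces:
  assumes "interval_interlacing s N f g" "i \<le> j" "j < N"
  shows "interlaces s (f i) (g j)"
  using interval_interlacingD[OF assms(1), of i j "Suc i" "Suc j"] assms(2,3) by simp

lemma interval_interlacing_self:
  assumes interlaces_f: "\<And>i j. i \<le> j \<Longrightarrow> j < N \<Longrightarrow> interlaces s (f i) (f j)"
  shows "interval_interlacing s N f f"
  unfolding interval_interlacing_def
proof (intro allI impI)
  fix a b c d :: nat assume le: "a \<le> c" "b \<le> d" "d \<le> N"
  show "interlaces s (\<Sum>i=a..<b. f i) (\<Sum>i=c..<d. f i)"
  proof (cases "c \<le> b")
    case False
    then show ?thesis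
      using le by (intro interlaces_sum_left interlaces_sum_right interlaces_f) auto
  next
    case True
    have left: "(\<Sum>i=a..<b. f i) = (\<Sum>i=a..<c. f i) + (\<Sum>i=c..<b. f i)"
      and right: "(\<Sum>i=c..<d. f i) = (\<Sum>i=c..<b. f i) + (\<Sum>i=b..<d. f i)"
      using True le by (simp_all add: sum.atLeastLessThan_concat)
    show ?thesis
      unfolding left right using True le
      by (intro interlaces_add_left interlaces_add_right interlaces_refl
          interlaces_sum_left interlaces_sum_right interlaces_f) auto
  qed
qed

lemma interval_interlacing_add_right:
  assumes "interval_interlacing s N f g"
    and "\<And>i j. i < N \<Longrightarrow> j < N \<Longrightarrow> interlaces s (f i) (h j)"
  shows "interval_interlacing s N f (\<lambda>j. g j + h j)"
  unfolding interval_interlacing_def sum.distrib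
proof (intro allI impI interlaces_add_right)
  fix a b c d :: nat assume le: "a \<le> c" "b \<le> d" "d \<le> N"
  show "interlaces s (\<Sum>i=a..<b. f i) (\<Sum>i=c..<d. g i)"
    using assms(1) le by (rule interval_interlacingD)
  show "interlaces s (\<Sum>i=a..<b. f i) (\<Sum>i=c..<d. h i)"
    using le by (intro interlaces_sum_left interlaces_sum_right assms(2)) auto
qed

context
  fixes s :: complex and N :: nat and f g :: "nat \<Rightarrow> complex"
  assumes interlacing_f: "interval_interlacing s N f f"
    and interlacing_g: "interval_interlacing s N g g"
    and interlacing_fg: "interval_interlacing s N f g"
begin

lemma interval_interlacing_tail_sums:
  "interval_interlacing s (Suc N) (\<lambda>j. \<Sum>i=j..<N. g i) (\<lambda>j. \<Sum>i=j..<N. g i)"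
  by (rule interval_interlacing_self) (auto intro: interval_interlacingD[OF interlacing_g])

lemma interval_interlacing_tail_sums_step:
  "interval_interlacing s (Suc N) (\<lambda>j. \<Sum>i=j..<N. g i)
    (\<lambda>j. (\<Sum>i=j..<N. g i) + s * (\<Sum>i=0..<j. f i))"
  by (rule interval_interlacing_add_right[OF interval_interlacing_tail_sums])
    (auto intro!: interlaces_rotate interval_interlacingD[OF interlacing_fg])

lemma interval_interlacing_step:
  "interval_interlacing s (Suc N) (\<lambda>j. (\<Sum>i=j..<N. g i) + s * (\<Sum>i=0..<j. f i))
    (\<lambda>j. (\<Sum>i=j..<N. g i) + s * (\<Sum>i=0..<j. f i))"
proof (rule interval_interlacing_self)
  fix j l assume "j \<le> l" "l < Suc N"
  define b e where "b = (\<Sum>i=j..<l. g i)" and "e = (\<Sum>i=j..<l. f i)"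
  define p q where "p = (\<Sum>i=l..<N. g i)" and "q = (\<Sum>i=0..<j. f i)"
  note block_defs = b_def e_def p_def q_def
  have sums: "(\<Sum>i=j..<N. g i) = b + p" "(\<Sum>i=0..<l. f i) = q + e"
    using \<open>j \<le> l\<close> \<open>l < Suc N\<close> by (simp_all add: block_defs sum.atLeastLessThan_concat)
  have "interlaces s b p"
    unfolding block_defs
    by (rule interval_interlacingD[OF interlacing_g]) (use \<open>j \<le> l\<close> \<open>l < Suc N\<close> in auto)
  moreover have "interlaces s b (s * q)" "interlaces s b (s * e)" "interlaces s p (s * e)"
    unfolding block_defs using \<open>j \<le> l\<close> \<open>l < Suc N\<close>
    by (auto intro!: interlaces_rotate interval_interlacingD[OF interlacing_fg])
  moreover have "interlaces s (s * q) (s * e)"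
    unfolding block_defs
    by (intro interlaces_mult interval_interlacingD[OF interlacing_f]) (use \<open>j \<le> l\<close> \<open>l < Suc N\<close> in auto)
  ultimately have "interlaces s (b + (p + s * q)) ((p + s * q) + s * e)"
    by (intro interlaces_add_left[of s b] interlaces_add_right[of s _ "p + s * q"] interlaces_refl)
      (auto intro: interlaces_add_left interlaces_add_right)
  then show "interlaces s ((\<Sum>i=j..<N. g i) + s * (\<Sum>i=0..<j. f i))
      ((\<Sum>i=l..<N. g i) + s * (\<Sum>i=0..<l. f i))"
    unfolding sums p_def[symmetric] q_def[symmetric] by (simp only: distrib_left add.assoc)
qed

end

lemma chow_gamma_interlacing:
  "interval_interlacing s (Suc K) (chow_gamma s K) (chow_gamma s K)"
  "interval_interlacing s (Suc K) (chow_gamma_tail s K) (chow_gamma_tail s K)"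
  "interval_interlacing s (Suc K) (chow_gamma_tail s K) (chow_gamma s K)"
proof (induction K)
  case 0
  show "interval_interlacing s (Suc 0) (chow_gamma s 0) (chow_gamma s 0)"
    and "interval_interlacing s (Suc 0) (chow_gamma_tail s 0) (chow_gamma_tail s 0)"
    by (auto intro!: interval_interlacing_self interlaces_refl)
  show "interval_interlacing s (Suc 0) (chow_gamma_tail s 0) (chow_gamma s 0)"
    by (simp add: interval_interlacing_def)
next
  case (Suc K)
  have chow_gamma_Suc: "chow_gamma s (Suc K) =
      (\<lambda>j. (\<Sum>i=j..<Suc K. chow_gamma s K i) + s * (\<Sum>i=0..<j. chow_gamma_tail s K i))"
    "chow_gamma_tail s (Suc K) = (\<lambda>j. \<Sum>i=j..<Suc K. chow_gamma s K i)"
    by (simp_all only: fun_eq_iff chow_gamma.simps chow_gamma_tail.simps simp_thms)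
  show "interval_interlacing s (Suc (Suc K)) (chow_gamma s (Suc K)) (chow_gamma s (Suc K))"
    unfolding chow_gamma_Suc using Suc.IH by (intro interval_interlacing_step)
  show "interval_interlacing s (Suc (Suc K)) (chow_gamma_tail s (Suc K)) (chow_gamma_tail s (Suc K))"
    unfolding chow_gamma_Suc using Suc.IH by (intro interval_interlacing_tail_sums)
  show "interval_interlacing s (Suc (Suc K)) (chow_gamma_tail s (Suc K)) (chow_gamma s (Suc K))"
    unfolding chow_gamma_Suc using Suc.IH by (intro interval_interlacing_tail_sums_step)
qed

lemma weighted_sum_chow_gamma_nonzero:
  fixes s :: complex and w :: "nat \<Rightarrow> real"
  assumes "s \<notin> \<real>\<^sub>\<le>\<^sub>0" and "0 < w 0" and "\<And>j. 0 \<le> w j"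
  shows "(\<Sum>j\<le>K. of_real (w j) * chow_gamma s K j) \<noteq> 0"
  using assms(2,3)
proof (induction K arbitrary: w)
  case 0
  then show ?case by simp
next
  case (Suc K)
  have "chow_gamma s (Suc K) 0 = (\<Sum>j\<le>K. of_real 1 * chow_gamma s K j)"
    by (simp add: atLeast0LessThan lessThan_Suc_atMost del: sum.op_ivl_Suc)
  also have "\<dots> \<noteq> 0" by (rule Suc.IH) auto
  finally show ?case
    using Suc.prems interval_interlacing_imp_interlaces[OF chow_gamma_interlacing(1)]
    by (intro weighted_sum_nonzero_if_interlaces[OF assms(1)]) (auto simp del: chow_gamma.simps)
qed

lemma gamma_variable_not_nonpos_Real:
  fixes t :: complex
  assumes "t \<notin> \<real>"
  shows "t / (1 + t)\<^sup>2 \<notin> \<real>\<^sub>\<le>\<^sub>0"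
proof
  have "1 + t \<noteq> 0" using assms by (metis Reals_1 Reals_minus add_eq_0_iff)
  assume "t / (1 + t)\<^sup>2 \<in> \<real>\<^sub>\<le>\<^sub>0"
  then obtain x where x_eq: "t / (1 + t)\<^sup>2 = of_real x" and "x \<le> 0"
    by (rule nonpos_Reals_cases)
  define r :: complex where "r = of_real (- x)"
  have "r \<in> \<real>" by (simp add: r_def)
  have t_eq: "t = - r * (1 + t)\<^sup>2"
    using x_eq \<open>1 + t \<noteq> 0\<close> by (simp add: r_def divide_eq_eq)
  then have "r \<noteq> 0" using assms by auto
  have "(2 * r * t + 2 * r + 1)\<^sup>2 = 4 * r * (r * (1 + t)\<^sup>2 + t) + (4 * r + 1)"
    by (simp add: power2_eq_square algebra_simps)
  also have "r * (1 + t)\<^sup>2 + t = 0"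
    using t_eq by (simp add: eq_neg_iff_add_eq_0 add.commute)
  also have "4 * r * 0 + (4 * r + 1) = (of_real (sqrt (1 - 4 * x)))\<^sup>2"
    using \<open>x \<le> 0\<close> by (simp add: r_def flip: of_real_power)
  finally have "2 * r * t + 2 * r + 1 \<in> \<real>"
    unfolding power2_eq_iff by (metis Reals_minus Reals_of_real)
  then have "(2 * r * t + 2 * r + 1 - (2 * r + 1)) / (2 * r) \<in> \<real>"
    using \<open>r \<in> \<real>\<close> by (intro Reals_divide Reals_diff) auto
  then show False using assms \<open>r \<noteq> 0\<close> by simp
qed

section \<open>Real-rootedness\<close>

abbreviation (input) ipoly :: "int poly \<Rightarrow> 'a::comm_ring_1 \<Rightarrow> 'a" where
  "ipoly p x \<equiv> poly (map_poly of_int p) x"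

lemma ipoly_add: "ipoly (p + q) x = ipoly p x + ipoly q x"
proof -
  have "map_poly of_int (p + q) = (map_poly of_int p + map_poly of_int q :: 'a poly)"
    by (rule poly_eqI) (simp add: coeff_map_poly)
  then show ?thesis by simp
qed

lemma ipoly_mult: "ipoly (p * q) x = ipoly p x * ipoly q x"
proof -
  have "map_poly of_int (p * q) = (map_poly of_int p * map_poly of_int q :: 'a poly)"
    by (rule poly_eqI) (simp add: coeff_map_poly coeff_mult)
  then show ?thesis by simp
qed

lemma ipoly_sum: "ipoly (\<Sum>i\<in>A. f i) x = (\<Sum>i\<in>A. ipoly (f i) x)"
  by (induction A rule: infinite_finite_induct) (auto simp: ipoly_add)

lemma ipoly_of_nat: "ipoly (of_nat m) x = of_nat m"
  by (simp add: of_nat_poly map_poly_pCons)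

lemma ipoly_power: "ipoly (p ^ m) x = ipoly p x ^ m"
  by (induction m) (simp_all add: ipoly_mult)

lemma ipoly_q_int: "ipoly (q_int p m) x = q_int (ipoly p x) m"
  by (simp add: q_int_def ipoly_sum ipoly_power)

lemma ipoly_derangement_poly: "ipoly (derangement_poly p m) x = derangement_poly (ipoly p x) m"
  by (induction p m rule: derangement_poly.induct)
    (simp_all add: derangement_poly.simps(2) ipoly_sum ipoly_mult ipoly_of_nat ipoly_q_int)

lemma ipoly_uniform_chow: "ipoly (uniform_chow p k n) x = uniform_chow (ipoly p x) k n"
  by (simp add: uniform_chow_def ipoly_sum ipoly_mult ipoly_of_nat ipoly_q_int ipoly_derangement_poly)

lemma uniform_chow_nonzero:
  fixes t :: complex
  assumes "1 \<le> k" "k \<le> n" "t \<notin> \<real>"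
  shows "uniform_chow t k n \<noteq> 0"
proof -
  obtain K where K: "k = Suc K" using assms(1) by (cases k) auto
  have "1 + t \<noteq> 0" using assms(3) by (metis Reals_1 Reals_minus add_eq_0_iff)
  then have "uniform_chow t k n = (1 + t) ^ K *
      (\<Sum>j\<le>K. of_real (real (n - Suc K + j choose j)) * chow_gamma (t / (1 + t)\<^sup>2) K j)"
    using uniform_chow_eq_sum_chow_gamma[of t K n] assms(2) K by simp
  moreover have "(\<Sum>j\<le>K. of_real (real (n - Suc K + j choose j)) *
      chow_gamma (t / (1 + t)\<^sup>2) K j) \<noteq> 0"
    by (intro weighted_sum_chow_gamma_nonzero gamma_variable_not_nonpos_Real assms(3)) auto
  ultimately show ?thesis using \<open>1 + t \<noteq> 0\<close> by simp
qed

theorem theorem1p1: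
  fixes k n :: nat and z :: complex
  assumes "1 \<le> k" and "k \<le> n"
    and "poly (map_poly of_int (chow_poly (uniform_lattice k n))) z = 0"
  shows "z \<in> \<real>"
proof (rule ccontr)
  assume "z \<notin> \<real>"
  have "ipoly (chow_poly (uniform_lattice k n)) z = uniform_chow (ipoly [:0, 1:] z) k n"
    unfolding chow_poly_uniform_lattice[OF assms(1,2)] by (rule ipoly_uniform_chow)
  also have "ipoly [:0, 1:] z = z"
    by (simp add: map_poly_pCons)
  also have "uniform_chow z k n \<noteq> 0"
    using assms(1,2) \<open>z \<notin> \<real>\<close> by (rule uniform_chow_nonzero)
  finally show False using assms(3) by contradiction
qed

end
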